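(* Let $T$ be a monoid, $M$ a $T$-graded monad on $\mathbf{Set}$ and $\mathcal{L}=(\Theta,\mathcal{O},\Lambda)$ a graded coalgebraic modal logic for $M$ with truth-value set $\Omega$. Then $\mathcal{L}$ is invariant with respect to behavioural equivalence: whenever states $x\in X$ and $y\in Y$ of graded $M$-coalgebras $(X,\gamma)$ and $(Y,\delta)$ are behaviourally equivalent, they are logically equivalent, i.e. $[\![\phi]\!]_\gamma(x)=[\![\phi]\!]_\delta(y)$ for all formulae $\phi$ of $\mathcal{L}$.
   Context: A $T$-graded monad $M$ on $\mathbf{Set}$, for a monoid $(T,\cdot,e)$, consists of endofunctors $M_t$ ($t\in T$) and natural transformations $\mu^{s,t}\colon M_sM_t\to M_{s\cdot t}$, $\eta\colon\mathrm{Id}\to M_e$ such that $\mu^{r,s\cdot t}\circ M_r\mu^{s,t}=\mu^{r\cdot s,t}\circ\mu^{r,s}M_t$ and $\mu^{t,e}\circ M_t\eta=\mathrm{id}=\mu^{e,t}\circ\eta M_t$. A graded $M$-coalgebra is a set $X$ with maps $\gamma_t\colon X\to M_tX$ such that $\gamma_e=\eta_X$ and $\gamma_{s\cdot t}=\mu^{s,t}_X\circ M_s\gamma_t\circ\gamma_s$. A homomorphism $h\colon(X,\gamma)\to(Y,\delta)$ is a map with $M_th\circ\gamma_t=\delta_t\circ h$ for all $t$. States $x\in X$, $y\in Y$ are behaviourally equivalent if there are a graded $M$-coalgebra $(Z,\xi)$ and homomorphisms $g\colon(X,\gamma)\to(Z,\xi)$, $h\colon(Y,\delta)\to(Z,\xi)$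 with $g(x)=h(y)$. A graded coalgebraic modal logic $\mathcal{L}=(\Theta,\mathcal{O},\Lambda)$ consists of a set $\Theta$ of constants, a set $\mathcal{O}$ of propositional operators $p$ with finite arities $\mathrm{ar}(p)\in\mathbb{N}$, and a set $\Lambda$ of (unary) modal operators $\lambda$ with depths $\mathsf{d}(\lambda)\in T$. Formulae are generated by $\phi::=\theta\mid p(\phi_1,\dots,\phi_{\mathrm{ar}(p)})\mid\lambda\phi$. The semantics is given by a set $\Omega$ of truth values, elements $\hat\theta\colon1\to\Omega$, maps $[\![p]\!]\colon\Omega^{\mathrm{ar}(p)}\to\Omega$ and maps $[\![\lambda]\!]\colon M_{\mathsf{d}(\lambda)}\Omega\to\Omega$. For a graded coalgebra $(X,\gamma)$, the map $[\![\phi]\!]_\gamma\colon X\to\Omega$ is defined by: $[\![\theta]\!]_\gamma$ is constant with value $\hat\theta$; $[\![p(\phi_1,\dots,\phi_n)]\!]_\gamma=[\![p]\!]\circ\langle[\![\phi_1]\!]_\gamma,\dots,[\![\phi_n]\!]_\gamma\rangle$; $[\![\lambda\phi]\!]_\gamma=[\![\lambda]\!]\circ M_{\mathsf{d}(\lambda)}[\![\phi]\!]_\gamma\circ\gamma_{\mathsf{d}(\lambda)}$. *)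

theory Defs
  imports Main "HOL-Library.FuncSet"
begin

text \<open>
  The category of sets is rendered as a family \<open>U\<close> of sets over a type \<open>'u\<close>: the objects are the
  members of \<open>U\<close> and the hom-set from \<open>A\<close> to \<open>B\<close> is all of \<open>A \<rightarrow>\<^sub>E B\<close>, with composition
  \<open>compose A g f\<close> and identity \<open>\<lambda>x\<in>A. x\<close>. HOL has no type of all sets, so "small" has to be
  relative to \<open>U\<close>. No closure conditions are imposed on \<open>U\<close>; when \<open>U\<close> is a Grothendieck universe
  this is the usual category of small sets.
\<close>

text \<open>
  The action on arrows takes the domain and the codomain as explicit arguments, since a HOL
  function does not determine them.
\<close>

definition set_endofunctor ::
  "'u set set \<Rightarrow> ('u set \<Rightarrow> 'u set) \<Rightarrow> ('u set \<Rightarrow> 'u set \<Rightarrow> ('u \<Rightarrow> 'u) \<Rightarrow> 'u \<Rightarrow> 'u) \<Rightarrow> bool" where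
  "set_endofunctor U F Fmap \<longleftrightarrow>
     (\<forall>A\<in>U. F A \<in> U) \<and>
     (\<forall>A\<in>U. \<forall>B\<in>U. \<forall>f \<in> A \<rightarrow>\<^sub>E B. Fmap A B f \<in> F A \<rightarrow>\<^sub>E F B) \<and>
     (\<forall>A\<in>U. Fmap A A (\<lambda>x\<in>A. x) = (\<lambda>x\<in>F A. x)) \<and>
     (\<forall>A\<in>U. \<forall>B\<in>U. \<forall>C\<in>U. \<forall>f \<in> A \<rightarrow>\<^sub>E B. \<forall>g \<in> B \<rightarrow>\<^sub>E C.
        Fmap A C (compose A g f) = compose (F A) (Fmap B C g) (Fmap A B f))"

definition set_nat_trans ::
  "'u set set \<Rightarrow> ('u set \<Rightarrow> 'u set) \<Rightarrow> ('u set \<Rightarrow> 'u set \<Rightarrow> ('u \<Rightarrow> 'u) \<Rightarrow> 'u \<Rightarrow> 'u) \<Rightarrow>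
   ('u set \<Rightarrow> 'u set) \<Rightarrow> ('u set \<Rightarrow> 'u set \<Rightarrow> ('u \<Rightarrow> 'u) \<Rightarrow> 'u \<Rightarrow> 'u) \<Rightarrow>
   ('u set \<Rightarrow> 'u \<Rightarrow> 'u) \<Rightarrow> bool" where
  "set_nat_trans U F Fmap G Gmap \<alpha> \<longleftrightarrow>
     (\<forall>A\<in>U. \<alpha> A \<in> F A \<rightarrow>\<^sub>E G A) \<and>
     (\<forall>A\<in>U. \<forall>B\<in>U. \<forall>f \<in> A \<rightarrow>\<^sub>E B.
        compose (F A) (\<alpha> B) (Fmap A B f) = compose (F A) (Gmap A B f) (\<alpha> A))"

record ('t, 'u) graded_monad_data =
  Ob :: "'t \<Rightarrow> 'u set \<Rightarrow> 'u set"
  Fm :: "'t \<Rightarrow> 'u set \<Rightarrow> 'u set \<Rightarrow> ('u \<Rightarrow> 'u) \<Rightarrow> 'u \<Rightarrow> 'u"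
  mult :: "'t \<Rightarrow> 't \<Rightarrow> 'u set \<Rightarrow> 'u \<Rightarrow> 'u"
  unit :: "'u set \<Rightarrow> 'u \<Rightarrow> 'u"

definition graded_monad ::
  "'u set set \<Rightarrow> ('t::monoid_mult, 'u) graded_monad_data \<Rightarrow> bool" where
  "graded_monad U M \<longleftrightarrow>
     (\<forall>t. set_endofunctor U (Ob M t) (Fm M t)) \<and>
     (\<forall>s t. set_nat_trans U
        (\<lambda>A. Ob M s (Ob M t A)) (\<lambda>A B f. Fm M s (Ob M t A) (Ob M t B) (Fm M t A B f))
        (Ob M (s * t)) (Fm M (s * t))
        (mult M s t)) \<and>
     set_nat_trans U (\<lambda>A. A) (\<lambda>A B f. f) (Ob M 1) (Fm M 1) (unit M) \<and>
     (\<forall>r s t. \<forall>A\<in>U.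
        compose (Ob M r (Ob M s (Ob M t A)))
          (mult M r (s * t) A) (Fm M r (Ob M s (Ob M t A)) (Ob M (s * t) A) (mult M s t A)) =
        compose (Ob M r (Ob M s (Ob M t A)))
          (mult M (r * s) t A) (mult M r s (Ob M t A))) \<and>
     (\<forall>t. \<forall>A\<in>U.
        compose (Ob M t A) (mult M t 1 A) (Fm M t A (Ob M 1 A) (unit M A)) = (\<lambda>x\<in>Ob M t A. x)) \<and>
     (\<forall>t. \<forall>A\<in>U.
        compose (Ob M t A) (mult M 1 t A) (unit M (Ob M t A)) = (\<lambda>x\<in>Ob M t A. x))"

definition graded_coalgebra ::
  "'u set set \<Rightarrow> ('t::monoid_mult, 'u) graded_monad_data \<Rightarrow> 'u set \<Rightarrow> ('t \<Rightarrow> 'u \<Rightarrow> 'u) \<Rightarrow> bool" where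
  "graded_coalgebra U M X \<gamma> \<longleftrightarrow>
     X \<in> U \<and> (\<forall>t. \<gamma> t \<in> X \<rightarrow>\<^sub>E Ob M t X) \<and> \<gamma> 1 = unit M X \<and>
     (\<forall>s t. \<gamma> (s * t) =
        compose X (mult M s t X) (compose X (Fm M s X (Ob M t X) (\<gamma> t)) (\<gamma> s)))"

definition coalgebra_hom ::
  "('t, 'u) graded_monad_data \<Rightarrow> 'u set \<Rightarrow> ('t \<Rightarrow> 'u \<Rightarrow> 'u) \<Rightarrow> 'u set \<Rightarrow> ('t \<Rightarrow> 'u \<Rightarrow> 'u) \<Rightarrow>
   ('u \<Rightarrow> 'u) \<Rightarrow> bool" where
  "coalgebra_hom M X \<gamma> Y \<delta> h \<longleftrightarrow>
     h \<in> X \<rightarrow>\<^sub>E Y \<and> (\<forall>t. compose X (Fm M t X Y h) (\<gamma> t) = compose X (\<delta> t) h)"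

definition behaviourally_equivalent ::
  "'u set set \<Rightarrow> ('t::monoid_mult, 'u) graded_monad_data \<Rightarrow>
   'u set \<Rightarrow> ('t \<Rightarrow> 'u \<Rightarrow> 'u) \<Rightarrow> 'u \<Rightarrow> 'u set \<Rightarrow> ('t \<Rightarrow> 'u \<Rightarrow> 'u) \<Rightarrow> 'u \<Rightarrow> bool" where
  "behaviourally_equivalent U M X \<gamma> x Y \<delta> y \<longleftrightarrow>
     (\<exists>Z \<xi> g h. graded_coalgebra U M Z \<xi> \<and>
        coalgebra_hom M X \<gamma> Z \<xi> g \<and> coalgebra_hom M Y \<delta> Z \<xi> h \<and> g x = h y)"

text \<open>
  The constants, operators and modalities form sets (possibly empty) inside types \<open>'c\<close>, \<open>'p\<close>,
  \<open>'l\<close>. Elements of \<open>\<Omega>\<^sup>n\<close> are lists of length \<open>n\<close> over \<open>\<Omega>\<close>.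
\<close>

record ('t, 'u, 'c, 'p, 'l) graded_logic_data =
  constants :: "'c set"
  operators :: "'p set"
  arity :: "'p \<Rightarrow> nat"
  modalities :: "'l set"
  depth :: "'l \<Rightarrow> 't"
  truth_values :: "'u set"
  const_val :: "'c \<Rightarrow> 'u"
  op_val :: "'p \<Rightarrow> 'u list \<Rightarrow> 'u"
  mod_val :: "'l \<Rightarrow> 'u \<Rightarrow> 'u"

definition graded_logic ::
  "'u set set \<Rightarrow> ('t, 'u) graded_monad_data \<Rightarrow> ('t, 'u, 'c, 'p, 'l) graded_logic_data \<Rightarrow> bool" where
  "graded_logic U M L \<longleftrightarrow>
     truth_values L \<in> U \<and>
     (\<forall>c \<in> constants L. const_val L c \<in> truth_values L) \<and>
     (\<forall>p \<in> operators L.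
        op_val L p \<in> {vs. length vs = arity L p \<and> set vs \<subseteq> truth_values L} \<rightarrow> truth_values L) \<and>
     (\<forall>l \<in> modalities L. mod_val L l \<in> Ob M (depth L l) (truth_values L) \<rightarrow> truth_values L)"

datatype ('c, 'p, 'l) formula =
    Const 'c
  | Op 'p "('c, 'p, 'l) formula list"
  | Modal 'l "('c, 'p, 'l) formula"

inductive_set formulae :: "('t, 'u, 'c, 'p, 'l) graded_logic_data \<Rightarrow> ('c, 'p, 'l) formula set"
  for L where
  Const: "c \<in> constants L \<Longrightarrow> Const c \<in> formulae L"
| Op: "p \<in> operators L \<Longrightarrow> length \<phi>s = arity L p \<Longrightarrow> (\<forall>\<phi> \<in> set \<phi>s. \<phi> \<in> formulae L) \<Longrightarrow>
       Op p \<phi>s \<in> formulae L"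
| Modal: "l \<in> modalities L \<Longrightarrow> \<phi> \<in> formulae L \<Longrightarrow> Modal l \<phi> \<in> formulae L"

fun semantics ::
  "('t, 'u) graded_monad_data \<Rightarrow> ('t, 'u, 'c, 'p, 'l) graded_logic_data \<Rightarrow>
   'u set \<Rightarrow> ('t \<Rightarrow> 'u \<Rightarrow> 'u) \<Rightarrow> ('c, 'p, 'l) formula \<Rightarrow> 'u \<Rightarrow> 'u" where
  "semantics M L X \<gamma> (Const c) = (\<lambda>x\<in>X. const_val L c)"
| "semantics M L X \<gamma> (Op p \<phi>s) = (\<lambda>x\<in>X. op_val L p (map (\<lambda>\<phi>. semantics M L X \<gamma> \<phi> x) \<phi>s))"
| "semantics M L X \<gamma> (Modal l \<phi>) =
     compose X (mod_val L l)
       (compose X (Fm M (depth L l) X (truth_values L) (semantics M L X \<gamma> \<phi>)) (\<gamma> (depth L l)))"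

definition logically_equivalent ::
  "('t, 'u) graded_monad_data \<Rightarrow> ('t, 'u, 'c, 'p, 'l) graded_logic_data \<Rightarrow>
   'u set \<Rightarrow> ('t \<Rightarrow> 'u \<Rightarrow> 'u) \<Rightarrow> 'u \<Rightarrow> 'u set \<Rightarrow> ('t \<Rightarrow> 'u \<Rightarrow> 'u) \<Rightarrow> 'u \<Rightarrow> bool" where
  "logically_equivalent M L X \<gamma> x Y \<delta> y \<longleftrightarrow>
     (\<forall>\<phi> \<in> formulae L. semantics M L X \<gamma> \<phi> x = semantics M L Y \<delta> \<phi> y)"

end

theory Submission
  imports Defs
begin

text \<open>Coalgebra homomorphisms preserve the meaning of formulae: if h goes from (X, \<gamma>)
  to (Z, \<xi>), then the semantics on X is the semantics on Z precomposed with h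
  (\<open>semantics_coalgebra_hom\<close>, by induction on the formula). The modal case rests on
  functoriality of each M_t and the homomorphism square. A cospan identifying x and y thus gives
  both states the value of their common image in Z. Functoriality is only assumed for arrows of the
  right hom-set, so \<open>semantics_funcset\<close> first shows that formulae denote maps into the
  truth values.\<close>

lemma semantics_funcset:
  assumes M: "graded_monad U M" and L: "graded_logic U M L" and X: "graded_coalgebra U M X \<gamma>"
    and "\<phi> \<in> formulae L"
  shows "semantics M L X \<gamma> \<phi> \<in> X \<rightarrow>\<^sub>E truth_values L"
  using assms(4)
proof induction
  case (Const c)
  then show ?case
    using L by (auto simp: graded_logic_def)
next
  case (Op p \<phi>s)
  have "op_val L p (map (\<lambda>\<phi>. semantics M L X \<gamma> \<phi> x) \<phi>s) \<in> truth_values L" if "x \<in> X" for x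
  proof -
    \<comment> \<open>\<open>op_val\<close> is only constrained on lists of the right length with
      entries among the truth values.\<close>
    have "set (map (\<lambda>\<phi>. semantics M L X \<gamma> \<phi> x) \<phi>s) \<subseteq> truth_values L"
      using Op that by auto
    then show ?thesis
      using L Op by (auto simp: graded_logic_def Pi_iff)
  qed
  then show ?case
    by auto
next
  case (Modal l \<phi>)
  let ?t = "depth L l" and ?\<Omega> = "truth_values L"
  have "Fm M ?t X ?\<Omega> (semantics M L X \<gamma> \<phi>) \<in> Ob M ?t X \<rightarrow>\<^sub>E Ob M ?t ?\<Omega>"
    using M L X Modal.IH
    by (simp add: graded_monad_def set_endofunctor_def graded_logic_def graded_coalgebra_def)
  moreover have "\<gamma> ?t \<in> X \<rightarrow>\<^sub>E Ob M ?t X"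
    using X by (simp add: graded_coalgebra_def)
  moreover have "mod_val L l \<in> Ob M ?t ?\<Omega> \<rightarrow> ?\<Omega>"
    using L Modal.hyps by (simp add: graded_logic_def)
  ultimately show ?case
    by (auto simp: compose_def PiE_iff Pi_iff extensional_def)
qed

text \<open>Constants ignore the state and operators act pointwise, so only modalities use the
  coalgebra structure. Equality holds as functions since both sides are \<open>undefined\<close> off
  \<open>X\<close>.\<close>

lemma semantics_coalgebra_hom:
  assumes M: "graded_monad U M" and L: "graded_logic U M L"
    and X: "graded_coalgebra U M X \<gamma>" and Z: "graded_coalgebra U M Z \<xi>"
    and h: "coalgebra_hom M X \<gamma> Z \<xi> h"
    and "\<phi> \<in> formulae L"
  shows "semantics M L X \<gamma> \<phi> = compose X (semantics M L Z \<xi> \<phi>) h"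
  using assms(6)
proof induction
  case (Const c)
  then show ?case
    \<comment> \<open>The restriction to \<open>Z\<close> is harmless because \<open>h\<close> lands
      in \<open>Z\<close>.\<close>
    using h by (auto simp: compose_def coalgebra_hom_def PiE_iff)
next
  case (Op p \<phi>s)
  show ?case
  proof
    fix x
    show "semantics M L X \<gamma> (Op p \<phi>s) x = compose X (semantics M L Z \<xi> (Op p \<phi>s)) h x"
    proof (cases "x \<in> X")
      case True
      then have "h x \<in> Z"
        using h by (auto simp: coalgebra_hom_def)
      moreover have "map (\<lambda>\<phi>. semantics M L X \<gamma> \<phi> x) \<phi>s = map (\<lambda>\<phi>. semantics M L Z \<xi> \<phi> (h x)) \<phi>s"
        using Op True by (auto simp: compose_eq)
      ultimately show ?thesis
        \<comment> \<open>Without \<open>map_eq_conv\<close> the equation between the argument lists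
          stays a rewrite rule instead of being split into pointwise equations.\<close>
        using True by (simp add: compose_eq del: map_eq_conv)
    qed (simp add: compose_def)
  qed
next
  case (Modal l \<phi>)
  let ?t = "depth L l" and ?\<Omega> = "truth_values L"
  let ?sX = "semantics M L X \<gamma> \<phi>" and ?sZ = "semantics M L Z \<xi> \<phi>"
  have hXZ: "h \<in> X \<rightarrow>\<^sub>E Z" and nat: "compose X (Fm M ?t X Z h) (\<gamma> ?t) = compose X (\<xi> ?t) h"
    using h by (auto simp: coalgebra_hom_def)
  have sZ: "?sZ \<in> Z \<rightarrow>\<^sub>E ?\<Omega>"
    using semantics_funcset[OF M L Z Modal.hyps(2)] .
  \<comment> \<open>The induction hypothesis factors \<open>?sX\<close> through \<open>h\<close>;
    \<open>Fm\<close> preserves this composite.\<close>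
  have Fm_sX: "Fm M ?t X ?\<Omega> ?sX = compose (Ob M ?t X) (Fm M ?t Z ?\<Omega> ?sZ) (Fm M ?t X Z h)"
    using M L X Z hXZ sZ unfolding Modal.IH
    by (simp add: graded_monad_def set_endofunctor_def graded_logic_def graded_coalgebra_def)
  show ?case
  proof
    fix x
    show "semantics M L X \<gamma> (Modal l \<phi>) x = compose X (semantics M L Z \<xi> (Modal l \<phi>)) h x"
    proof (cases "x \<in> X")
      case True
      then have "h x \<in> Z" "\<gamma> ?t x \<in> Ob M ?t X"
        using hXZ X by (auto simp: graded_coalgebra_def)
      \<comment> \<open>The homomorphism square at grade \<open>?t\<close>, evaluated at
        \<open>x\<close>, trades \<gamma> for \<xi>.\<close>
      moreover have "Fm M ?t X Z h (\<gamma> ?t x) = \<xi> ?t (h x)"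
        using fun_cong[OF nat, of x] True by (simp add: compose_eq)
      ultimately show ?thesis
        using True by (simp add: compose_eq Fm_sX)
    qed (simp add: compose_def)
  qed
qed

theorem theorem5p3:
  fixes U :: "'u set set"
    and M :: "('t::monoid_mult, 'u) graded_monad_data"
    and L :: "('t, 'u, 'c, 'p, 'l) graded_logic_data"
    and X Y :: "'u set"
    and \<gamma> \<delta> :: "'t \<Rightarrow> 'u \<Rightarrow> 'u"
    and x y :: 'u
  assumes "graded_monad U M"
    and "graded_logic U M L"
    and "graded_coalgebra U M X \<gamma>"
    and "graded_coalgebra U M Y \<delta>"
    and "x \<in> X"
    and "y \<in> Y"
    and "behaviourally_equivalent U M X \<gamma> x Y \<delta> y"
  shows "logically_equivalent M L X \<gamma> x Y \<delta> y"
proof -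
  obtain Z \<xi> g h where Z: "graded_coalgebra U M Z \<xi>" and g: "coalgebra_hom M X \<gamma> Z \<xi> g"
    and h: "coalgebra_hom M Y \<delta> Z \<xi> h" and eq: "g x = h y"
    using assms(7) unfolding behaviourally_equivalent_def by blast
  show ?thesis
    unfolding logically_equivalent_def
  proof
    fix \<phi> assume "\<phi> \<in> formulae L"
    then show "semantics M L X \<gamma> \<phi> x = semantics M L Y \<delta> \<phi> y"
      \<comment> \<open>As \<open>x\<close> and \<open>y\<close> lie in the carriers, both
        composites evaluate, to the semantics on \<open>Z\<close> at \<open>g x\<close> and at
        \<open>h y\<close>.\<close>
      using semantics_coalgebra_hom[OF assms(1-3) Z g] semantics_coalgebra_hom[OF assms(1,2,4) Z h]
        assms(5,6) eq by (simp add: compose_eq)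
  qed
qed

end
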